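(* Let $F_t$, $0\le t<t_0$, be a bounded one-parameter family on $\mathbb{R}^d$ and let $A^*$ be an upper transition attractor of $F_t$. Let $F^*=F_{t_0}$, let $q_*$ be the special fixed point, let $A_*$ be the lower transition attractor, and let $K^*$ be the transition hull of $F_t$. Then the following hold: (1) $A^*$ is $(F^*,q_* )$-invariant; (2) $A_*$ is the unique minimal (with respect to inclusion) $(F^*,q_* )$-invariant set; (3) $K^*$ is the unique minimal $(F^*,q_* )$-invariant convex set; (4) $\mathrm{conv}\,A_*=\mathrm{conv}\,A^*=K^*$; (5) $A_*=\overline{\bigcup_{n\ge 0}{F^*}^n(q_* )}$.
   Context: A function $f:\mathbb{R}^d\to\mathbb{R}^d$ is affine if $f(x)=Lx+a$, where $L$ is a non-singular $d\times d$ real matrix (the linear part of $f$) and $a\in\mathbb{R}^d$. A one-parameter affine family is given by $N\ge 2$ affine functions $F=\{f_1,\dots,f_N\}$ on $\mathbb{R}^d$ and vectors $q_1,\dots,q_N\in\mathbb{R}^d$; for each real $t\ge 0$ it is $F_t=\{f_{(i,t)} : 1\le i\le N\}$ with $f_{(i,t)}(x)=t f_i(x)+q_i$. It is a similarity family if each function is a similarity transformation. The Hutchinson operator of $F_t$ on non-empty compact sets is $F_t(K)=\bigcup_{f\in F_t} f(K)$, and $F_t^n$ denotes its $n$-fold composition. A non-empty compact set $A_t$ is the attractor of $F_t$ if $A_t=\lim_{k\to\infty}F_t^k(K)$ in the Hausdorff metric for every non-empty compact $K$. If $L_1,\dots,L_N$ are the linear parts of $f_1,\dots,f_N$, the joint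 spectral radius of $F$ is $\rho(F)=\limsup_{k\to\infty}\big(\max\|L_{i_1}\cdots L_{i_k}\|\big)^{1/k}$, the maximum being over all words of length $k$ in $\{1,\dots,N\}$. Set $t_0=1/\rho(F)$; the attractor $A_t$ exists exactly for $t\in[0,t_0)$. Functions $f,g$ on $\mathbb{R}^d$ are conjugate by a function $h$ if $g=h^{-1}fh$. The family $F_t$ is semi-linear if, for all $i$ and all $t\in[0,t_0)$, $f_{(i,t)}$ is conjugate to a linear function by a function $h_i$ independent of $t$. A one-parameter similarity family $F_t$ is bounded if it is semi-linear and there is a unique function $\widehat f_t(x)=t\widehat f(x)+q_*\in F_t$ such that $\widehat f$ has maximum scaling ratio (among $f_1,\dots,f_N$). The point $q_*$, which is a fixed point of $\widehat f_t$ for all $t\in[0,t_0]$, is called the special fixed point. For a bounded one-parameter family $F_t$: a compact set $A^*$ is an upper transition attractor if it is the limit (in the Hausdorff metric) of a sequence of attractors $A_{t_k}$, $k=1,2,\dots$, with $t_k\to t_0$ ($t_k<t_0$). Let $F^*:=F_{t_0}=\{t_0 f_i(x)+q_i : 1\le i\le N\}$. A non-empty compact set $X\subset\mathbb{R}^d$ is $(F^*,q_* )$-invariant if $F^*(X)=X$ and $q_*\in X$. The lower transition attractor is $A_*=\bigcap\{A : A\text{ non-empty compact and } (F^*,q_* )\text{-invariant}\}$. With $\mathrm{conv}$ denoting convex hull and the bar denoting closure, the transition hull is $K^*=\overline{\bigcup_{0\le t<t_0}\mathrm{conv}\,A_t}$. In (5), ${F^*}^n(q_* )$ means ${F^*}^n(\{q_*\})$.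 *)

theory Defs
  imports "HOL-Analysis.Analysis"
begin

section \<open>Affine maps and similarities\<close>

definition affine_map :: "(real^'d \<Rightarrow> real^'d) \<Rightarrow> bool" where
  "affine_map f \<longleftrightarrow> (\<exists>L a. invertible L \<and> f = (\<lambda>x. L *v x + a))"

definition linear_part :: "(real^'d \<Rightarrow> real^'d) \<Rightarrow> real^'d^'d" where
  "linear_part f = (THE L. \<exists>a. f = (\<lambda>x. L *v x + a))"

definition has_scaling_ratio :: "(real^'d \<Rightarrow> real^'d) \<Rightarrow> real \<Rightarrow> bool" where
  "has_scaling_ratio f r \<longleftrightarrow> r > 0 \<and> (\<forall>x y. dist (f x) (f y) = r * dist x y)"

definition similarity :: "(real^'d \<Rightarrow> real^'d) \<Rightarrow> bool" where
  "similarity f \<longleftrightarrow> (\<exists>r. has_scaling_ratio f r)"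

definition scaling_ratio :: "(real^'d \<Rightarrow> real^'d) \<Rightarrow> real" where
  "scaling_ratio f = (THE r. has_scaling_ratio f r)"

text \<open>Conjugation is by an arbitrary bijection; no regularity of \<open>h\<close> is required.\<close>

definition conjugate_by :: "('a \<Rightarrow> 'a) \<Rightarrow> ('a \<Rightarrow> 'a) \<Rightarrow> ('a \<Rightarrow> 'a) \<Rightarrow> bool" where
  "conjugate_by h f g \<longleftrightarrow> bij h \<and> g = inv h \<circ> f \<circ> h"


section \<open>Hutchinson operator, Hausdorff metric, attractors\<close>

definition hutchinson :: "('a \<Rightarrow> 'a) set \<Rightarrow> 'a set \<Rightarrow> 'a set" where
  "hutchinson F K = (\<Union>f\<in>F. f ` K)"

text \<open>The suprema below are meaningful, and \<open>hausdorff_distance\<close> is a metric, only on non-empty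
  compact sets; convergence is therefore stated for such sets only.\<close>

definition hausdorff_distance :: "('a::metric_space) set \<Rightarrow> 'a set \<Rightarrow> real" where
  "hausdorff_distance A B = max (SUP a\<in>A. infdist a B) (SUP b\<in>B. infdist b A)"

definition hausdorff_limit :: "(nat \<Rightarrow> ('a::metric_space) set) \<Rightarrow> 'a set \<Rightarrow> bool" where
  "hausdorff_limit X A \<longleftrightarrow>
     (\<forall>k. compact (X k) \<and> X k \<noteq> {}) \<and> compact A \<and> A \<noteq> {} \<and>
     (\<lambda>k. hausdorff_distance (X k) A) \<longlonglongrightarrow> 0"

definition is_attractor :: "(('a::metric_space) \<Rightarrow> 'a) set \<Rightarrow> 'a set \<Rightarrow> bool" where
  "is_attractor F A \<longleftrightarrow> compact A \<and> A \<noteq> {} \<and>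
     (\<forall>K. compact K \<and> K \<noteq> {} \<longrightarrow> hausdorff_limit (\<lambda>k. (hutchinson F ^^ k) K) A)"

definition attractor :: "(('a::metric_space) \<Rightarrow> 'a) set \<Rightarrow> 'a set" where
  "attractor F = (THE A. is_attractor F A)"


section \<open>One-parameter families\<close>

text \<open>A family is given by \<open>N\<close>, the maps \<open>f 1, \<dots>, f N\<close> and the vectors \<open>q 1, \<dots>, q N\<close>; the values
  of \<open>f\<close> and \<open>q\<close> at other indices are irrelevant.\<close>

definition family_map ::
  "(nat \<Rightarrow> real^'d \<Rightarrow> real^'d) \<Rightarrow> (nat \<Rightarrow> real^'d) \<Rightarrow> nat \<Rightarrow> real \<Rightarrow> real^'d \<Rightarrow> real^'d" where
  "family_map f q i t = (\<lambda>x. t *\<^sub>R f i x + q i)"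

definition family ::
  "nat \<Rightarrow> (nat \<Rightarrow> real^'d \<Rightarrow> real^'d) \<Rightarrow> (nat \<Rightarrow> real^'d) \<Rightarrow> real \<Rightarrow> (real^'d \<Rightarrow> real^'d) set" where
  "family N f q t = (\<lambda>i. family_map f q i t) ` {1..N}"

definition affine_family :: "nat \<Rightarrow> (nat \<Rightarrow> real^'d \<Rightarrow> real^'d) \<Rightarrow> bool" where
  "affine_family N f \<longleftrightarrow> N \<ge> 2 \<and> (\<forall>i\<in>{1..N}. affine_map (f i))"

definition similarity_family :: "nat \<Rightarrow> (nat \<Rightarrow> real^'d \<Rightarrow> real^'d) \<Rightarrow> bool" where
  "similarity_family N f \<longleftrightarrow> affine_family N f \<and> (\<forall>i\<in>{1..N}. similarity (f i))"

definition word_product :: "(nat \<Rightarrow> real^'d \<Rightarrow> real^'d) \<Rightarrow> nat list \<Rightarrow> real^'d^'d" where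
  "word_product f w = foldr (\<lambda>i M. linear_part (f i) ** M) w (mat 1)"

definition max_word_norm :: "nat \<Rightarrow> (nat \<Rightarrow> real^'d \<Rightarrow> real^'d) \<Rightarrow> nat \<Rightarrow> real" where
  "max_word_norm N f k =
     Max ((\<lambda>w. onorm ((*v) (word_product f w))) ` {w. set w \<subseteq> {1..N} \<and> length w = k})"

text \<open>\<open>limsup\<close> needs a complete linear order, hence the detour through \<open>ereal\<close>; for an affine family
  the value is finite and positive.\<close>

definition joint_spectral_radius :: "nat \<Rightarrow> (nat \<Rightarrow> real^'d \<Rightarrow> real^'d) \<Rightarrow> real" where
  "joint_spectral_radius N f =
     real_of_ereal (limsup (\<lambda>k. ereal (root k (max_word_norm N f k))))"

definition threshold :: "nat \<Rightarrow> (nat \<Rightarrow> real^'d \<Rightarrow> real^'d) \<Rightarrow> real" where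
  "threshold N f = 1 / joint_spectral_radius N f"

definition semi_linear ::
  "nat \<Rightarrow> (nat \<Rightarrow> real^'d \<Rightarrow> real^'d) \<Rightarrow> (nat \<Rightarrow> real^'d) \<Rightarrow> bool" where
  "semi_linear N f q \<longleftrightarrow>
     (\<forall>i\<in>{1..N}. \<exists>h. \<forall>t\<in>{0..<threshold N f}. \<exists>g. linear g \<and> conjugate_by h (family_map f q i t) g)"

text \<open>The one-parameter function \<open>t \<mapsto> t f + q\<close> is represented by the pair \<open>(f, q)\<close>. Uniqueness of the
  map of maximum scaling ratio refers to the function, not to its index, so that a repetition in
  the list \<open>f 1, \<dots>, f N\<close> does no harm.\<close>

definition has_max_ratio ::
  "nat \<Rightarrow> (nat \<Rightarrow> real^'d \<Rightarrow> real^'d) \<Rightarrow> (nat \<Rightarrow> real^'d) \<Rightarrow> (real^'d \<Rightarrow> real^'d) \<times> (real^'d) \<Rightarrow> bool"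
  where
  "has_max_ratio N f q u \<longleftrightarrow>
     u \<in> (\<lambda>i. (f i, q i)) ` {1..N} \<and> (\<forall>j\<in>{1..N}. scaling_ratio (f j) \<le> scaling_ratio (fst u))"

definition bounded_family ::
  "nat \<Rightarrow> (nat \<Rightarrow> real^'d \<Rightarrow> real^'d) \<Rightarrow> (nat \<Rightarrow> real^'d) \<Rightarrow> bool" where
  "bounded_family N f q \<longleftrightarrow>
     similarity_family N f \<and> semi_linear N f q \<and> (\<exists>!u. has_max_ratio N f q u)"

definition special_point ::
  "nat \<Rightarrow> (nat \<Rightarrow> real^'d \<Rightarrow> real^'d) \<Rightarrow> (nat \<Rightarrow> real^'d) \<Rightarrow> real^'d" where
  "special_point N f q = snd (THE u. has_max_ratio N f q u)"


section \<open>Transition attractors and the transition hull\<close>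

definition upper_transition_attractor ::
  "nat \<Rightarrow> (nat \<Rightarrow> real^'d \<Rightarrow> real^'d) \<Rightarrow> (nat \<Rightarrow> real^'d) \<Rightarrow> (real^'d) set \<Rightarrow> bool" where
  "upper_transition_attractor N f q A \<longleftrightarrow>
     (\<exists>t :: nat \<Rightarrow> real. (\<forall>k. 0 \<le> t k \<and> t k < threshold N f) \<and> t \<longlonglongrightarrow> threshold N f \<and>
        hausdorff_limit (\<lambda>k. attractor (family N f q (t k))) A)"

definition invariant :: "('a \<Rightarrow> 'a) set \<Rightarrow> 'a \<Rightarrow> ('a::topological_space) set \<Rightarrow> bool" where
  "invariant F p X \<longleftrightarrow> compact X \<and> X \<noteq> {} \<and> hutchinson F X = X \<and> p \<in> X"

definition lower_transition_attractor ::
  "nat \<Rightarrow> (nat \<Rightarrow> real^'d \<Rightarrow> real^'d) \<Rightarrow> (nat \<Rightarrow> real^'d) \<Rightarrow> (real^'d) set" where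
  "lower_transition_attractor N f q =
     \<Inter> {A. invariant (family N f q (threshold N f)) (special_point N f q) A}"

definition transition_hull ::
  "nat \<Rightarrow> (nat \<Rightarrow> real^'d \<Rightarrow> real^'d) \<Rightarrow> (nat \<Rightarrow> real^'d) \<Rightarrow> (real^'d) set" where
  "transition_hull N f q =
     closure (\<Union>t\<in>{0..<threshold N f}. convex hull (attractor (family N f q t)))"

definition minimal_set :: "('a set \<Rightarrow> bool) \<Rightarrow> 'a set \<Rightarrow> bool" where
  "minimal_set P X \<longleftrightarrow> P X \<and> (\<forall>Y. P Y \<and> Y \<subseteq> X \<longrightarrow> Y = X)"

definition unique_minimal_set :: "('a set \<Rightarrow> bool) \<Rightarrow> 'a set \<Rightarrow> bool" where
  "unique_minimal_set P X \<longleftrightarrow> minimal_set P X \<and> (\<forall>Y. minimal_set P Y \<longrightarrow> Y = X)"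

end

theory Submission
  imports Defs
begin

text \<open>Two observations carry the proof. First, a semi-linear family is pinned to its vectors: at
  \<open>t = 0\<close> the conjugating map must send \<open>0\<close> to \<open>q i\<close>, so \<open>q i\<close> is fixed for every \<open>t\<close> and
  \<open>family_map f q i t x = q i + t L\<^sub>i (x - q i)\<close> with \<open>L\<^sub>i\<close> multiplying norms by
  \<open>r i\<close>. The joint spectral radius is therefore the maximal ratio \<open>r m\<close>. Below \<open>t\<^sub>0 = 1 / r m\<close> all maps are contractions, and at \<open>t\<^sub>0\<close> the
  maps split in two kinds: isometries fixing \<open>p = q m\<close>, and genuine contractions
  (\<open>bounded_family_normalized\<close>). Second, for \<open>0 \<le> s \<le> t\<close> and \<open>t \<noteq> 0\<close> the point \<open>family_map f q i s x\<close>
  lies on the segment from \<open>q i\<close> to \<open>family_map f q i t x\<close>, so that a convex set which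
  contains all \<open>q i\<close> and is mapped into itself at parameter \<open>t\<close> is mapped into itself at every smaller parameter
  (\<open>forward_invariant_smaller_parameter\<close>).

  A large ball around \<open>p\<close> is mapped into itself for all \<open>t \<le> t\<^sub>0\<close>, because the contractions that do
  not fix \<open>p\<close> have ratio bounded away from \<open>1\<close>. Hence the closure \<open>M\<close> of the orbit of \<open>p\<close> is compact
  for each such \<open>t\<close>; since \<open>p\<close> is a fixed point, the orbit sets increase and \<open>M\<close> is invariant. For
  \<open>t < t\<^sub>0\<close> this \<open>M\<close> is the attractor. For \<open>t = t\<^sub>0\<close> it lies in every invariant set that contains \<open>p\<close>,
  so it is the lower transition attractor.

  At \<open>t\<^sub>0\<close> a compact set \<open>X\<close> with \<open>F X \<subseteq> X\<close> already satisfies \<open>F X = X\<close>, because \<open>F\<close> contains an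
  isometry and an isometry of a compact set into itself is onto. This gives the invariance of limits
  of attractors, where only the inclusion is evident, and the invariance of \<open>conv M\<close>.

  Finally, let \<open>A\<close> be an upper transition attractor and \<open>K\<close> the transition hull. The set \<open>conv M\<close>
  contains all \<open>q i\<close>, each being \<open>p\<close> or the limit of the orbit of \<open>p\<close> under a single contraction; by
  the second observation it contains every attractor, so \<open>K \<subseteq> conv M\<close>. Minimality of \<open>M\<close> gives
  \<open>conv M \<subseteq> conv A\<close>. The hulls of the attractors increase with \<open>t\<close>, again by the second observation,
  so \<open>K\<close> is convex; being closed, it contains \<open>A\<close> and hence \<open>conv A\<close>. The three sets coincide.\<close>

section \<open>The Hausdorff distance and convergence of points\<close>

text \<open>Compactness bounds the two distance functions, so the suprema are true upper bounds.\<close>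

lemma infdist_le_hausdorff_distance:
  fixes A B :: "('a::metric_space) set"
  assumes "compact A" "compact B"
  shows "a \<in> A \<Longrightarrow> infdist a B \<le> hausdorff_distance A B"
    and "b \<in> B \<Longrightarrow> infdist b A \<le> hausdorff_distance A B"
proof -
  have "bdd_above ((\<lambda>a. infdist a B) ` A)" "bdd_above ((\<lambda>b. infdist b A) ` B)"
    using assms by (auto intro!: bounded_imp_bdd_above compact_imp_bounded
        compact_continuous_image continuous_on_infdist continuous_on_id)
  then show "a \<in> A \<Longrightarrow> infdist a B \<le> hausdorff_distance A B"
    and "b \<in> B \<Longrightarrow> infdist b A \<le> hausdorff_distance A B"
    unfolding hausdorff_distance_def
    by - (rule max.coboundedI1, erule (1) cSUP_upper, rule max.coboundedI2, erule (1) cSUP_upper)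
qed

lemma hausdorff_distance_le:
  assumes "A \<noteq> {}" "B \<noteq> {}"
    and "\<And>a. a \<in> A \<Longrightarrow> \<exists>b\<in>B. dist a b \<le> e"
    and "\<And>b. b \<in> B \<Longrightarrow> \<exists>a\<in>A. dist b a \<le> e"
  shows "hausdorff_distance A B \<le> e"
  unfolding hausdorff_distance_def using assms
  by (auto intro!: cSUP_least intro: infdist_le2)

text \<open>By the triangle inequality, the distance from \<open>a\<close> to the limit set is at most
  \<open>hausdorff_distance (X k) A + dist a (x k)\<close>. This lemma and the next reduce all later questions about
  limits of sets to limits of points.\<close>

lemma hausdorff_limit_mem:
  assumes lim: "hausdorff_limit X A" and x: "\<And>k. x k \<in> X k" "x \<longlonglongrightarrow> a"
  shows "a \<in> A"
proof -
  have X: "\<And>k. compact (X k)" and A: "compact A" "A \<noteq> {}"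
    and h: "(\<lambda>k. hausdorff_distance (X k) A) \<longlonglongrightarrow> 0"
    using lim by (auto simp: hausdorff_limit_def)
  have "(\<lambda>k. dist a (x k)) \<longlonglongrightarrow> 0"
    using x(2) by (simp add: tendsto_dist_iff[of x] dist_commute)
  then have "(\<lambda>k. hausdorff_distance (X k) A + dist a (x k)) \<longlonglongrightarrow> 0 + 0"
    by (rule tendsto_add[OF h])
  moreover have "infdist a A \<le> hausdorff_distance (X k) A + dist a (x k)" for k
    using infdist_triangle[of a A "x k"] infdist_le_hausdorff_distance(1)[OF X A(1) x(1)[of k]]
    by linarith
  ultimately have "infdist a A \<le> 0 + 0"
    using LIMSEQ_le_const by blast
  then show ?thesis
    using A in_closed_iff_infdist_zero[of A a] infdist_nonneg[of a A] compact_imp_closed by auto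
qed

lemma compact_infdist_attained:
  fixes S :: "('a::metric_space) set"
  assumes "compact S" "S \<noteq> {}"
  obtains y where "y \<in> S" "infdist x S = dist x y"
proof -
  have "continuous_on S (dist x)"
    by (intro continuous_intros)
  then obtain y where y: "y \<in> S" "\<forall>z\<in>S. dist x y \<le> dist x z"
    using continuous_attains_inf[OF assms] by blast
  have "dist x y \<le> infdist x S"
    unfolding infdist_notempty[OF assms(2)] using y assms(2) by (intro cINF_greatest) auto
  then show ?thesis
    using that y infdist_le[OF y(1), of x] by force
qed

text \<open>The point \<open>x k\<close> is a point of \<open>X k\<close> nearest to \<open>a\<close>.\<close>

lemma hausdorff_limit_approx:
  assumes lim: "hausdorff_limit X A" and a: "a \<in> A"
  obtains x where "\<And>k. x k \<in> X k" "x \<longlonglongrightarrow> a"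
proof -
  have X: "\<And>k. compact (X k)" "\<And>k. X k \<noteq> {}" and A: "compact A"
    and h: "(\<lambda>k. hausdorff_distance (X k) A) \<longlonglongrightarrow> 0"
    using lim by (auto simp: hausdorff_limit_def)
  have "\<exists>y\<in>X k. infdist a (X k) = dist a y" for k
    using compact_infdist_attained[of "X k" a] X[of k] by blast
  then obtain x where x: "\<And>k. x k \<in> X k" "\<And>k. infdist a (X k) = dist a (x k)"
    by metis
  have "(\<lambda>k. dist (x k) a) \<longlonglongrightarrow> 0"
    using infdist_le_hausdorff_distance(2)[OF X(1) A a] x(2)
    by (intro tendsto_sandwich[OF _ _ tendsto_const h]) (auto simp: dist_commute)
  then show ?thesis
    using that x(1) tendsto_dist_iff by blast
qed

lemma hausdorff_limit_unique:
  assumes "hausdorff_limit X A" "hausdorff_limit X B"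
  shows "A = B"
proof -
  have "A \<subseteq> B" if AB: "hausdorff_limit X A" "hausdorff_limit X B" for A B
  proof
    fix a assume "a \<in> A"
    then obtain x where "\<And>k. x k \<in> X k" "x \<longlonglongrightarrow> a"
      using hausdorff_limit_approx[OF AB(1)] by blast
    then show "a \<in> B"
      using hausdorff_limit_mem[OF AB(2)] by blast
  qed
  then show ?thesis
    using assms by blast
qed


section \<open>Orbit closures under the Hutchinson operator\<close>

lemma hutchinson_mono: "A \<subseteq> B \<Longrightarrow> hutchinson F A \<subseteq> hutchinson F B"
  unfolding hutchinson_def by blast

lemma hutchinson_funpow_subset:
  assumes "hutchinson F X \<subseteq> X" "Y \<subseteq> X"
  shows "(hutchinson F ^^ n) Y \<subseteq> X"
proof (induction n)
  case (Suc n)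
  then show ?case
    using hutchinson_mono[OF Suc, of F] assms by auto
qed (use assms in auto)

lemma compact_hutchinson:
  assumes "finite F" "\<And>g. g \<in> F \<Longrightarrow> continuous_on UNIV g" "compact X"
  shows "compact (hutchinson F X)"
  unfolding hutchinson_def using assms
  by (intro compact_UN compact_continuous_image) (auto intro: continuous_on_subset)

lemma hutchinson_nonempty: "F \<noteq> {} \<Longrightarrow> X \<noteq> {} \<Longrightarrow> hutchinson F X \<noteq> {}"
  unfolding hutchinson_def by auto

text \<open>Every closed forward invariant set containing \<open>p\<close> contains the orbit of \<open>p\<close>; this is the
  minimality of orbit closures.\<close>

lemma orbit_closure_subset:
  assumes "closed X" "hutchinson F X \<subseteq> X" "p \<in> X"
  shows "closure (\<Union>n. (hutchinson F ^^ n) {p}) \<subseteq> X"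
  using assms by (intro closure_minimal UN_least hutchinson_funpow_subset) auto

text \<open>Because \<open>p\<close> is a fixed point of one of the maps, it is not lost when the Hutchinson operator is
  applied: the image of the union \<open>U\<close> of all iterates is the union of the iterates from the first
  on, and \<open>p\<close> lies in the first. So \<open>hutchinson F U = U\<close>. Finitely many continuous maps send the compact closure of \<open>U\<close> to a compact
  set, so this equation passes to the closure.\<close>

lemma orbit_closure_invariant:
  fixes F :: "('a::metric_space \<Rightarrow> 'a) set"
  assumes fin: "finite F" and cont: "\<And>g. g \<in> F \<Longrightarrow> continuous_on UNIV g"
    and B: "compact B" "hutchinson F B \<subseteq> B" "p \<in> B"
    and g: "g \<in> F" "g p = p"
  shows "invariant F p (closure (\<Union>n. (hutchinson F ^^ n) {p}))"
proof -
  define U where "U = (\<Union>n. (hutchinson F ^^ n) {p})"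
  have pU: "p \<in> U"
    unfolding U_def by (rule UN_I[of 0]) auto
  have FU: "hutchinson F U = (\<Union>n. (hutchinson F ^^ Suc n) {p})"
    unfolding U_def by (auto simp: hutchinson_def)
  have "U \<subseteq> hutchinson F U"
  proof
    fix x assume "x \<in> U"
    then obtain n where n: "x \<in> (hutchinson F ^^ n) {p}"
      by (auto simp: U_def)
    show "x \<in> hutchinson F U"
    proof (cases n)
      case 0
      then have "x = g p"
        using n g by simp
      then show ?thesis
        using g pU unfolding hutchinson_def by blast
    next
      case (Suc k)
      then show ?thesis
        using n FU by blast
    qed
  qed
  moreover have "hutchinson F U \<subseteq> U"
    unfolding FU unfolding U_def by blast
  ultimately have eq: "hutchinson F U = U"
    by blast
  have "closure U \<subseteq> B"
    unfolding U_def using B by (intro orbit_closure_subset compact_imp_closed)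
  then have comp: "compact (closure U)"
    using B(1) by (metis closed_closure compact_Int_closed inf.absorb_iff2)
  have "hutchinson F (closure U) \<subseteq> closure U"
  proof -
    have "h ` closure U \<subseteq> closure U" if "h \<in> F" for h
    proof (rule image_closure_subset)
      show "continuous_on (closure U) h"
        using cont[OF that] continuous_on_subset by blast
      show "h ` U \<subseteq> closure U"
        using eq that closure_subset by (fastforce simp: hutchinson_def)
    qed simp
    then show ?thesis
      unfolding hutchinson_def by blast
  qed
  moreover have "closure U \<subseteq> hutchinson F (closure U)"
  proof (rule closure_minimal)
    show "U \<subseteq> hutchinson F (closure U)"
      using hutchinson_mono[OF closure_subset, of F U] eq by simp
    show "closed (hutchinson F (closure U))"
      using compact_hutchinson[OF fin cont comp] compact_imp_closed by blast
  qed
  ultimately have "hutchinson F (closure U) = closure U"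
    by (rule subset_antisym)
  moreover have "p \<in> closure U"
    using pU closure_subset by (rule rev_subsetD)
  ultimately show ?thesis
    using comp unfolding invariant_def U_def[symmetric] by (metis empty_iff)
qed


section \<open>Attractors of contractive systems\<close>

lemma hausdorff_distance_hutchinson_le:
  fixes F :: "('a::metric_space \<Rightarrow> 'a) set"
  assumes F: "F \<noteq> {}" and c: "\<And>g x y. g \<in> F \<Longrightarrow> dist (g x) (g y) \<le> c * dist x y" "0 \<le> c"
    and A: "compact A" "A \<noteq> {}" and B: "compact B" "B \<noteq> {}"
  shows "hausdorff_distance (hutchinson F A) (hutchinson F B) \<le> c * hausdorff_distance A B"
proof (rule hausdorff_distance_le)
  show "hutchinson F A \<noteq> {}" "hutchinson F B \<noteq> {}"
    using F A B by (simp_all add: hutchinson_nonempty)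
  have *: "\<exists>b\<in>hutchinson F B. dist a b \<le> c * h"
    if a: "a \<in> hutchinson F A" and AB: "\<And>a. a \<in> A \<Longrightarrow> infdist a B \<le> h"
      and B: "compact B" "B \<noteq> {}" for A B :: "'a set" and a h
  proof -
    obtain g x where g: "g \<in> F" "x \<in> A" "a = g x"
      using a by (auto simp: hutchinson_def)
    obtain y where y: "y \<in> B" "infdist x B = dist x y"
      using compact_infdist_attained[OF B] by blast
    have "dist a (g y) \<le> c * dist x y"
      using c g by simp
    also have "\<dots> \<le> c * h"
      using AB[OF g(2)] y c(2) by (simp add: mult_left_mono)
    finally show ?thesis
      using g y by (auto simp: hutchinson_def)
  qed
  show "\<exists>b\<in>hutchinson F B. dist a b \<le> c * hausdorff_distance A B" if "a \<in> hutchinson F A" for a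
    using *[OF that _ B] infdist_le_hausdorff_distance[OF A(1) B(1)] by blast
  show "\<exists>a\<in>hutchinson F A. dist b a \<le> c * hausdorff_distance A B" if "b \<in> hutchinson F B" for b
    using *[OF that _ A] infdist_le_hausdorff_distance[OF A(1) B(1)] by blast
qed

text \<open>The \<open>k\<close>-th iterate of \<open>K\<close> is within \<open>c ^ k\<close> times the initial Hausdorff distance of
  \<open>A\<close>.\<close>

lemma is_attractor_if_contractive:
  fixes F :: "('a::metric_space \<Rightarrow> 'a) set"
  assumes fin: "finite F" "F \<noteq> {}"
    and c: "\<And>g x y. g \<in> F \<Longrightarrow> dist (g x) (g y) \<le> c * dist x y" "0 \<le> c" "c < 1"
    and A: "compact A" "A \<noteq> {}" "hutchinson F A = A"
  shows "is_attractor F A"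
  unfolding is_attractor_def
proof (intro conjI allI impI)
  fix K :: "'a set" assume K: "compact K \<and> K \<noteq> {}"
  have cont: "continuous_on UNIV g" if "g \<in> F" for g
    using c(1)[OF that] c(2) by (intro lipschitz_on_continuous_on[of c] lipschitz_onI) auto
  have KK: "compact ((hutchinson F ^^ k) K) \<and> (hutchinson F ^^ k) K \<noteq> {}" for k
    using fin cont K by (induction k) (simp_all add: compact_hutchinson hutchinson_nonempty)
  have bound: "hausdorff_distance ((hutchinson F ^^ k) K) A \<le> c ^ k * hausdorff_distance K A" for k
  proof (induction k)
    case (Suc k)
    have "hausdorff_distance (hutchinson F ((hutchinson F ^^ k) K)) (hutchinson F A)
        \<le> c * hausdorff_distance ((hutchinson F ^^ k) K) A"
      using fin c A KK by (intro hausdorff_distance_hutchinson_le) auto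
    also have "\<dots> \<le> c * (c ^ k * hausdorff_distance K A)"
      using Suc c by (intro mult_left_mono)
    finally show ?case
      using A by simp
  qed simp
  have nonneg: "0 \<le> hausdorff_distance ((hutchinson F ^^ k) K) A" for k
  proof -
    obtain a where "a \<in> A"
      using A(2) by blast
    then show ?thesis
      using infdist_le_hausdorff_distance(2)[of "(hutchinson F ^^ k) K" A a] KK[of k] A(1)
        infdist_nonneg[of a "(hutchinson F ^^ k) K"] by linarith
  qed
  have "(\<lambda>k. c ^ k * hausdorff_distance K A) \<longlonglongrightarrow> 0"
    using c by (intro tendsto_mult_left_zero LIMSEQ_realpow_zero)
  then have "(\<lambda>k. hausdorff_distance ((hutchinson F ^^ k) K) A) \<longlonglongrightarrow> 0"
    by (rule tendsto_sandwich[OF always_eventually always_eventually tendsto_const, rotated 2])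
      (use bound nonneg in simp_all)
  then show "hausdorff_limit (\<lambda>k. (hutchinson F ^^ k) K) A"
    using KK A by (simp add: hausdorff_limit_def)
qed (use A in auto)

lemma is_attractor_unique:
  fixes F :: "('a::metric_space \<Rightarrow> 'a) set"
  assumes "is_attractor F A" "is_attractor F B"
  shows "A = B"
proof -
  have "hausdorff_limit (\<lambda>k. (hutchinson F ^^ k) {undefined}) X" if "is_attractor F X" for X
    using that unfolding is_attractor_def by simp
  from hausdorff_limit_unique[OF this[OF assms(1)] this[OF assms(2)]] show ?thesis .
qed

lemma attractor_eq: "is_attractor F A \<Longrightarrow> attractor F = A"
  unfolding attractor_def by (rule the_equality) (auto dest: is_attractor_unique)

text \<open>The iterates of \<open>C\<close> stay in the closed set \<open>C\<close> and converge to \<open>A\<close>.\<close>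

lemma is_attractor_subset:
  assumes "is_attractor F A" "compact C" "C \<noteq> {}" "hutchinson F C \<subseteq> C"
  shows "A \<subseteq> C"
proof
  fix a assume a: "a \<in> A"
  have "hausdorff_limit (\<lambda>k. (hutchinson F ^^ k) C) A"
    using assms by (auto simp: is_attractor_def)
  then obtain x where x: "\<And>k. x k \<in> (hutchinson F ^^ k) C" "x \<longlonglongrightarrow> a"
    using hausdorff_limit_approx a by blast
  have "x k \<in> C" for k
    using hutchinson_funpow_subset[OF assms(4) subset_refl] x(1) by blast
  then show "a \<in> C"
    using x(2) assms(2) compact_imp_closed closed_sequentially by blast
qed

lemma fixed_point_in_attractor:
  assumes "is_attractor F A" "g \<in> F" "g x = x"
  shows "x \<in> A"
proof -
  have "x \<in> (hutchinson F ^^ k) {x}" for k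
  proof (induction k)
    case (Suc k)
    then have "g x \<in> hutchinson F ((hutchinson F ^^ k) {x})"
      using assms(2) unfolding hutchinson_def by blast
    then show ?case
      using assms(3) by simp
  qed simp
  moreover have "hausdorff_limit (\<lambda>k. (hutchinson F ^^ k) {x}) A"
    using assms by (auto simp: is_attractor_def)
  ultimately show ?thesis
    using hausdorff_limit_mem[of _ A "\<lambda>_. x" x] by auto
qed


section \<open>Isometries of compact sets\<close>

text \<open>A point \<open>x\<close> outside the image has positive distance \<open>d\<close> from it, and then any two points of the
  orbit of \<open>x\<close> are at least \<open>d\<close> apart: cancel the smaller power of \<open>g\<close>. This contradicts
  compactness.\<close>

lemma isometry_image_compact_eq:
  fixes g :: "'a::metric_space \<Rightarrow> 'a"
  assumes X: "compact X" "g ` X \<subseteq> X"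
    and iso: "\<And>x y. dist (g x) (g y) = dist x y"
  shows "g ` X = X"
proof (rule ccontr)
  assume "g ` X \<noteq> X"
  then obtain x where x: "x \<in> X" "x \<notin> g ` X"
    using X(2) by blast
  have "continuous_on X g"
    using iso by (intro lipschitz_on_continuous_on[of 1] lipschitz_onI) auto
  then have "closed (g ` X)"
    using X(1) compact_continuous_image compact_imp_closed by blast
  then have d: "infdist x (g ` X) > 0"
    using x in_closed_iff_infdist_zero[of "g ` X" x] infdist_nonneg[of x "g ` X"] by force
  have mem: "(g ^^ n) x \<in> X" for n
    using x X(2) by (induction n) auto
  have iso_pow: "dist ((g ^^ n) y) ((g ^^ n) z) = dist y z" for n y z
    by (induction n) (simp_all add: iso)
  have sep: "infdist x (g ` X) \<le> dist ((g ^^ m) x) ((g ^^ n) x)" if mn: "m < n" for m n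
  proof -
    obtain k where k: "n = m + Suc k"
      using less_imp_Suc_add[OF mn] by auto
    have "(g ^^ n) x = (g ^^ m) ((g ^^ Suc k) x)"
      unfolding k by (simp only: funpow_add o_apply)
    then have "dist ((g ^^ m) x) ((g ^^ n) x) = dist x (g ((g ^^ k) x))"
      by (simp only: iso_pow funpow.simps o_apply)
    then show ?thesis
      using mem[of k] by (simp add: infdist_le)
  qed
  define u where "u n = (g ^^ n) x" for n
  have "\<forall>n. u n \<in> X"
    using mem by (simp add: u_def)
  with X(1) obtain l s where s: "strict_mono s" "(u \<circ> s) \<longlonglongrightarrow> l"
    unfolding compact_def by blast
  have "Cauchy (u \<circ> s)"
    using LIMSEQ_imp_Cauchy[OF s(2)] .
  then obtain M where M: "\<And>m n. m \<ge> M \<Longrightarrow> n \<ge> M \<Longrightarrow>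
      dist ((g ^^ s m) x) ((g ^^ s n) x) < infdist x (g ` X)"
    using metric_CauchyD[OF _ d, of "u \<circ> s"] by (auto simp: u_def)
  show False
    using M[of M "Suc M"] sep[OF strict_monoD[OF s(1), of M "Suc M"]] by simp
qed

section \<open>The joint spectral radius of a similarity family\<close>

lemma exists_unit_vector: "\<exists>x :: real^'d. norm x = 1"
  using norm_axis_1 by blast

lemma scaling_ratio_eq:
  fixes f :: "real^'d \<Rightarrow> real^'d"
  assumes "has_scaling_ratio f r"
  shows "scaling_ratio f = r"
  unfolding scaling_ratio_def
proof (rule the_equality)
  fix s assume s: "has_scaling_ratio f s"
  obtain x :: "real^'d" where "norm x = 1"
    using exists_unit_vector by blast
  then have "dist x 0 = 1"
    by simp
  then show "s = r"
    using s assms unfolding has_scaling_ratio_def by (metis mult.right_neutral)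
qed (rule assms)

lemma linear_part_eq:
  assumes "f = (\<lambda>x. L *v x + a)"
  shows "linear_part f = L"
  unfolding linear_part_def
proof (rule the_equality)
  fix M assume "\<exists>b. f = (\<lambda>x. M *v x + b)"
  then obtain b where b: "f = (\<lambda>x. M *v x + b)"
    by blast
  have "b = a"
    using fun_cong[OF b, of 0] assms by simp
  then have "M *v x = L *v x" for x
    using fun_cong[OF b, of x] assms by simp
  then show "M = L"
    by (simp add: matrix_eq)
qed (use assms in blast)

lemma similarity_linear_part:
  fixes f :: "real^'d \<Rightarrow> real^'d"
  assumes "affine_map f" "similarity f"
  shows "f x = linear_part f *v x + f 0"
    and "norm (linear_part f *v x) = scaling_ratio f * norm x"
    and "scaling_ratio f > 0"
proof -
  obtain L a where L: "f = (\<lambda>x. L *v x + a)"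
    using assms by (auto simp: affine_map_def)
  obtain r where r: "has_scaling_ratio f r"
    using assms by (auto simp: similarity_def)
  note eqs = linear_part_eq[OF L] scaling_ratio_eq[OF r]
  show "f x = linear_part f *v x + f 0"
    unfolding eqs by (simp add: L)
  have "dist (f x) (f 0) = r * dist x 0"
    using r by (auto simp: has_scaling_ratio_def)
  then show "norm (linear_part f *v x) = scaling_ratio f * norm x"
    unfolding eqs by (simp add: L dist_norm)
  show "scaling_ratio f > 0"
    using r eqs by (auto simp: has_scaling_ratio_def)
qed

text \<open>The index type of the vectors is non-empty, so there is a unit vector on which the bound is
  attained.\<close>

lemma onorm_eq_if_similarity:
  fixes g :: "real^'d \<Rightarrow> real^'d"
  assumes "linear g" "\<And>x. norm (g x) = c * norm x"
  shows "onorm g = c"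
proof (rule antisym)
  show "onorm g \<le> c"
    using assms(2) by (intro onorm_le) simp
  obtain x :: "real^'d" where "norm x = 1"
    using exists_unit_vector by blast
  then show "c \<le> onorm g"
    using onorm[of g x] assms linear_conv_bounded_linear by auto
qed

lemma similarity_familyD:
  assumes "similarity_family N f" "i \<in> {1..N}"
  shows "affine_map (f i)" "similarity (f i)"
  using assms by (auto simp: similarity_family_def affine_family_def)

lemma norm_word_product:
  assumes "similarity_family N f" "set w \<subseteq> {1..N}"
  shows "norm (word_product f w *v x) = (\<Prod>i\<leftarrow>w. scaling_ratio (f i)) * norm x"
  using assms(2)
proof (induction w)
  case (Cons i w)
  have i: "i \<in> {1..N}"
    using Cons.prems by simp
  have "norm (word_product f (i # w) *v x) = norm (linear_part (f i) *v (word_product f w *v x))"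
    by (simp add: word_product_def matrix_vector_mul_assoc)
  also have "\<dots> = scaling_ratio (f i) * norm (word_product f w *v x)"
    using similarity_linear_part(2) similarity_familyD[OF assms(1) i] by blast
  finally show ?case
    using Cons by simp
qed (simp add: word_product_def)

text \<open>For similarities the norm of a product is the product of the ratios, so the maximum over words is
  attained by the constant word \<open>m \<dots> m\<close>.\<close>

lemma max_word_norm_similarity:
  fixes f :: "nat \<Rightarrow> real^'d \<Rightarrow> real^'d"
  assumes fam: "similarity_family N f"
    and m: "m \<in> {1..N}" "\<And>i. i \<in> {1..N} \<Longrightarrow> scaling_ratio (f i) \<le> scaling_ratio (f m)"
  shows "max_word_norm N f k = scaling_ratio (f m) ^ k"
proof -
  define W where "W = {w. set w \<subseteq> {1..N} \<and> length w = k}"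
  have pos: "scaling_ratio (f i) > 0" if "i \<in> {1..N}" for i
    using similarity_linear_part(3) similarity_familyD[OF fam that] by blast
  have onorm: "onorm ((*v) (word_product f w)) = (\<Prod>i\<leftarrow>w. scaling_ratio (f i))" if "w \<in> W" for w
    using that norm_word_product[OF fam] by (intro onorm_eq_if_similarity) (auto simp: W_def)
  have bound: "0 \<le> (\<Prod>i\<leftarrow>w. scaling_ratio (f i)) \<and>
      (\<Prod>i\<leftarrow>w. scaling_ratio (f i)) \<le> scaling_ratio (f m) ^ length w" if "set w \<subseteq> {1..N}" for w
    using that
  proof (induction w)
    case (Cons i w)
    then show ?case
      using m pos[of i] pos[OF m(1)] by (auto intro!: mult_mono mult_nonneg_nonneg)
  qed simp
  have "Max ((\<lambda>w. onorm ((*v) (word_product f w))) ` W) = scaling_ratio (f m) ^ k"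
  proof (rule Max_eqI)
    show "finite ((\<lambda>w. onorm ((*v) (word_product f w))) ` W)"
      unfolding W_def by (intro finite_imageI finite_lists_length_eq) simp
    show "y \<le> scaling_ratio (f m) ^ k" if "y \<in> (\<lambda>w. onorm ((*v) (word_product f w))) ` W" for y
      using that onorm bound by (auto simp: W_def)
    have rep: "replicate k m \<in> W"
      using m by (auto simp: W_def)
    have "onorm ((*v) (word_product f (replicate k m))) = scaling_ratio (f m) ^ k"
      unfolding onorm[OF rep] by simp
    then show "scaling_ratio (f m) ^ k \<in> (\<lambda>w. onorm ((*v) (word_product f w))) ` W"
      using rep by force
  qed
  then show ?thesis
    by (simp add: max_word_norm_def W_def)
qed

lemma threshold_similarity:
  fixes f :: "nat \<Rightarrow> real^'d \<Rightarrow> real^'d"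
  assumes fam: "similarity_family N f"
    and m: "m \<in> {1..N}" "\<And>i. i \<in> {1..N} \<Longrightarrow> scaling_ratio (f i) \<le> scaling_ratio (f m)"
  shows "threshold N f = 1 / scaling_ratio (f m)"
proof -
  have pos: "scaling_ratio (f m) > 0"
    using similarity_linear_part(3) similarity_familyD[OF fam m(1)] by blast
  have "eventually (\<lambda>k. ereal (root k (max_word_norm N f k)) = ereal (scaling_ratio (f m))) sequentially"
    using eventually_gt_at_top[of 0]
  proof eventually_elim
    case (elim k)
    have "max_word_norm N f k = scaling_ratio (f m) ^ k"
      using max_word_norm_similarity[OF fam m] .
    then show ?case
      using pos elim by (simp add: real_root_power_cancel)
  qed
  then have "limsup (\<lambda>k. ereal (root k (max_word_norm N f k)))
      = limsup (\<lambda>k::nat. ereal (scaling_ratio (f m)))"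
    by (rule Limsup_eq)
  then show ?thesis
    by (simp add: threshold_def joint_spectral_radius_def Limsup_const)
qed


section \<open>Normal form of a bounded family\<close>

text \<open>The conjugating map \<open>h\<close> sends the fixed point \<open>0\<close> of the linear maps to a common fixed point of
  all \<open>family_map f q i t\<close>. At \<open>t = 0\<close> this map is constantly \<open>q i\<close>, so the fixed point is \<open>q i\<close>; at any
  positive \<open>t\<close> the fixed point equation then says \<open>f i (q i) = 0\<close>.\<close>

lemma semi_linear_normal_form:
  fixes f :: "nat \<Rightarrow> real^'d \<Rightarrow> real^'d"
  assumes semi: "semi_linear N f q" and pos: "threshold N f > 0"
    and i: "i \<in> {1..N}" and aff: "affine_map (f i)"
  shows "f i x = linear_part (f i) *v (x - q i)"
proof -
  obtain h where h: "\<And>t. t \<in> {0..<threshold N f} \<Longrightarrow>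
      \<exists>g. linear g \<and> conjugate_by h (family_map f q i t) g"
    using semi i unfolding semi_linear_def by blast
  have fixed: "t *\<^sub>R f i (h 0) + q i = h 0" if t: "t \<in> {0..<threshold N f}" for t
  proof -
    obtain g where g: "linear g" "bij h" "g = inv h \<circ> family_map f q i t \<circ> h"
      using h[OF t] by (auto simp: conjugate_by_def)
    have "inv h (family_map f q i t (h 0)) = 0"
      using linear_0[OF g(1)] g(3) by simp
    then have "family_map f q i t (h 0) = h 0"
      using bij_inv_eq_iff[OF g(2)] by metis
    then show ?thesis
      by (simp add: family_map_def)
  qed
  have h0: "h 0 = q i"
    using fixed[of 0] pos by simp
  have "(threshold N f / 2) *\<^sub>R f i (q i) + q i = q i"
    using fixed[of "threshold N f / 2"] pos h0 by simp
  then have zero: "f i (q i) = 0"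
    using pos by simp
  obtain L a where L: "f i = (\<lambda>x. L *v x + a)"
    using aff by (auto simp: affine_map_def)
  have "f i x = f i x - f i (q i)"
    using zero by simp
  then show ?thesis
    unfolding linear_part_eq[OF L] by (simp add: L matrix_vector_mult_diff_distrib)
qed

text \<open>Maps of maximal ratio may occur several times in the list, but then with the same vector. The
  last assumption records exactly this consequence of uniqueness.\<close>

locale normalized_family =
  fixes N m :: nat
    and f :: "nat \<Rightarrow> real^'d \<Rightarrow> real^'d"
    and q :: "nat \<Rightarrow> real^'d"
    and L :: "nat \<Rightarrow> real^'d \<Rightarrow> real^'d"
    and r :: "nat \<Rightarrow> real"
  assumes m_in: "m \<in> {1..N}"
    and r_pos: "i \<in> {1..N} \<Longrightarrow> 0 < r i"
    and linear_L: "i \<in> {1..N} \<Longrightarrow> linear (L i)"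
    and norm_L: "i \<in> {1..N} \<Longrightarrow> norm (L i x) = r i * norm x"
    and f_eq: "i \<in> {1..N} \<Longrightarrow> f i x = L i (x - q i)"
    and dominant: "i \<in> {1..N} \<Longrightarrow> q i = q m \<and> r i = r m \<or> r i < r m"

lemma bounded_family_normalized:
  fixes f :: "nat \<Rightarrow> real^'d \<Rightarrow> real^'d"
  assumes "bounded_family N f q"
  obtains m where
    "normalized_family N m f q (\<lambda>i. (*v) (linear_part (f i))) (\<lambda>i. scaling_ratio (f i))"
    "threshold N f = 1 / scaling_ratio (f m)" "special_point N f q = q m"
proof -
  have fam: "similarity_family N f" and semi: "semi_linear N f q"
    and ex1: "\<exists>!u. has_max_ratio N f q u"
    using assms by (auto simp: bounded_family_def)
  define u where "u = (THE u. has_max_ratio N f q u)"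
  have u: "has_max_ratio N f q u"
    unfolding u_def by (rule theI'[OF ex1])
  have u_unique: "v = u" if "has_max_ratio N f q v" for v
    using ex1 u that by blast
  obtain m where m: "m \<in> {1..N}" "u = (f m, q m)"
    using u by (auto simp: has_max_ratio_def)
  have max: "scaling_ratio (f i) \<le> scaling_ratio (f m)" if "i \<in> {1..N}" for i
    using u that m by (auto simp: has_max_ratio_def)
  note sim = similarity_linear_part[OF similarity_familyD[OF fam]]
  have t0: "threshold N f = 1 / scaling_ratio (f m)"
    using threshold_similarity[OF fam m(1) max] .
  have "q i = q m \<and> scaling_ratio (f i) = scaling_ratio (f m) \<or> scaling_ratio (f i) < scaling_ratio (f m)"
    if i: "i \<in> {1..N}" for i
  proof (cases "scaling_ratio (f i) < scaling_ratio (f m)")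
    case False
    then have "scaling_ratio (f i) = scaling_ratio (f m)"
      using max[OF i] by simp
    then have "has_max_ratio N f q (f i, q i)"
      using i max by (simp add: has_max_ratio_def)
    then show ?thesis
      using u_unique m by auto
  qed simp
  moreover have "f i x = linear_part (f i) *v (x - q i)" if "i \<in> {1..N}" for i x
  proof -
    have "threshold N f > 0"
      using sim(3)[OF m(1) m(1)] t0 by simp
    then show ?thesis
      using semi_linear_normal_form[OF semi _ that] similarity_familyD(1)[OF fam that] by blast
  qed
  ultimately have "normalized_family N m f q (\<lambda>i. (*v) (linear_part (f i))) (\<lambda>i. scaling_ratio (f i))"
    using m(1) sim(2,3) by (intro normalized_family.intro matrix_vector_mul_linear) auto
  then show ?thesis
    using that t0 m(2) by (simp add: special_point_def u_def[symmetric])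
qed

context normalized_family
begin

lemma family_map_eq:
  "i \<in> {1..N} \<Longrightarrow> family_map f q i t x = q i + t *\<^sub>R L i (x - q i)"
  by (simp add: family_map_def f_eq)

lemma family_map_fixed: "i \<in> {1..N} \<Longrightarrow> family_map f q i t (q i) = q i"
  by (simp add: family_map_eq linear_0[OF linear_L])

lemma dist_family_map:
  assumes i: "i \<in> {1..N}" and t: "0 \<le> t"
  shows "dist (family_map f q i t x) (family_map f q i t y) = t * r i * dist x y"
proof -
  have "family_map f q i t x - family_map f q i t y = t *\<^sub>R L i (x - y)"
    by (simp add: family_map_eq[OF i] flip: scaleR_diff_right linear_diff[OF linear_L[OF i]])
  then show ?thesis
    using t by (simp add: dist_norm norm_L[OF i])
qed

lemma family_map_convex_combination:
  assumes "i \<in> {1..N}" "t \<noteq> 0"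
  shows "family_map f q i s x = (1 - s / t) *\<^sub>R q i + (s / t) *\<^sub>R family_map f q i t x"
  using assms by (simp add: family_map_eq algebra_simps)

lemma family_map_mem: "i \<in> {1..N} \<Longrightarrow> family_map f q i t \<in> family N f q t"
  by (simp add: family_def)

lemma family_finite_nonempty: "finite (family N f q t)" "family N f q t \<noteq> {}"
  using m_in by (auto simp: family_def)

lemma hutchinson_family_subset_iff:
  "hutchinson (family N f q t) X \<subseteq> Y \<longleftrightarrow>
     (\<forall>i\<in>{1..N}. \<forall>x\<in>X. family_map f q i t x \<in> Y)"
  by (auto simp: hutchinson_def family_def)

lemma continuous_on_family:
  assumes "g \<in> family N f q t"
  shows "continuous_on UNIV g"
proof -
  obtain i where i: "i \<in> {1..N}" "g = family_map f q i t"
    using assms by (auto simp: family_def)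
  have bl: "bounded_linear (L i)"
    using linear_L[OF i(1)] linear_conv_bounded_linear by blast
  have "g = (\<lambda>x. q i + t *\<^sub>R L i (x - q i))"
    using i family_map_eq by blast
  moreover have "continuous_on UNIV (\<lambda>x. L i (x - q i))"
    by (rule bounded_linear.continuous_on[OF bl]) (intro continuous_intros)
  ultimately show ?thesis
    by (simp add: continuous_on_add continuous_on_scaleR)
qed

section \<open>A common trapping ball and the attractors\<close>

text \<open>The parameter at which the dominant maps become isometries; it will be identified with the
  threshold of the family.\<close>

definition t0 :: real where "t0 = 1 / r m"

lemma t0_pos: "0 < t0"
  using r_pos[OF m_in] by (simp add: t0_def)

lemma t0_mult_less: "i \<in> {1..N} \<Longrightarrow> r i < r m \<Longrightarrow> t0 * r i < 1"
  using r_pos[OF m_in] by (simp add: t0_def field_simps)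

text \<open>One radius serves all \<open>t \<le> t0\<close>. Maps of maximal ratio fix the centre \<open>q m\<close> and do not increase
  distances. For the others put \<open>c = t0 * r i < 1\<close> and \<open>d = dist (q m) (q i)\<close>: a point of the ball
  is moved to distance at most \<open>d + c * (d + R)\<close> from the centre, and this is at most \<open>R\<close> as soon as
  \<open>2 * d / (1 - c) \<le> R\<close>.\<close>

lemma forward_invariant_ball:
  obtains R where "0 \<le> R"
    "\<And>t. 0 \<le> t \<Longrightarrow> t \<le> t0 \<Longrightarrow> hutchinson (family N f q t) (cball (q m) R) \<subseteq> cball (q m) R"
proof -
  \<comment> \<open>For indices of maximal ratio both numerator and denominator vanish, and \<open>0 / 0 = 0\<close>.\<close>
  define \<rho> where "\<rho> i = 2 * dist (q m) (q i) / (1 - t0 * r i)" for i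
  define R where "R = Max (\<rho> ` {1..N})"
  have \<rho>_le: "\<rho> i \<le> R" if "i \<in> {1..N}" for i
    unfolding R_def using that by (intro Max_ge) auto
  have R: "0 \<le> R"
    using \<rho>_le[OF m_in] by (simp add: \<rho>_def)
  have "dist (q m) (family_map f q i t x) \<le> R"
    if t: "0 \<le> t" "t \<le> t0" and i: "i \<in> {1..N}" and x: "dist (q m) x \<le> R" for t i x
  proof -
    have tr: "t * r i \<le> t0 * r i"
      using t r_pos[OF i] by simp
    have tr0: "0 \<le> t * r i"
      using t r_pos[OF i] by simp
    have eq: "dist (q i) (family_map f q i t x) = t * r i * dist (q i) x"
      using dist_family_map[OF i t(1), of "q i" x] family_map_fixed[OF i] by simp
    show ?thesis
      using dominant[OF i]
    proof
      assume same: "q i = q m \<and> r i = r m"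
      then have "t * r i \<le> 1"
        using tr r_pos[OF m_in] by (simp add: t0_def)
      then have "t * r i * dist (q m) x \<le> 1 * R"
        using x R by (intro mult_mono) auto
      then show ?thesis
        using eq same by simp
    next
      assume less: "r i < r m"
      have c: "t0 * r i < 1"
        using t0_mult_less[OF i less] .
      have "2 * dist (q m) (q i) \<le> R * (1 - t0 * r i)"
        using \<rho>_le[OF i] c by (simp add: \<rho>_def pos_divide_le_eq)
      moreover have "t * r i * dist (q i) x \<le> t0 * r i * (dist (q m) (q i) + R)"
      proof (rule mult_mono[OF tr])
        show "dist (q i) x \<le> dist (q m) (q i) + R"
          using x dist_triangle[of "q i" x "q m"] by (simp add: dist_commute)
      qed (use tr tr0 in auto)
      moreover have "t0 * r i * dist (q m) (q i) \<le> 1 * dist (q m) (q i)"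
        using c by (intro mult_right_mono) auto
      ultimately show ?thesis
        using eq dist_triangle[of "q m" "family_map f q i t x" "q i"] by (simp add: algebra_simps)
    qed
  qed
  then show ?thesis
    using that[OF R] by (simp add: hutchinson_family_subset_iff)
qed

lemma orbit_closure_family_invariant:
  assumes "0 \<le> t" "t \<le> t0"
  shows "invariant (family N f q t) (q m) (closure (\<Union>n. (hutchinson (family N f q t) ^^ n) {q m}))"
proof -
  obtain R where "0 \<le> R" "hutchinson (family N f q t) (cball (q m) R) \<subseteq> cball (q m) R"
    using forward_invariant_ball assms by metis
  then show ?thesis
    by (intro orbit_closure_invariant[OF family_finite_nonempty(1) continuous_on_family _ _ _
          family_map_mem[OF m_in] family_map_fixed[OF m_in]]) auto
qed

text \<open>Below \<open>t0\<close> the whole system contracts with ratio \<open>t * r m < 1\<close>, and the orbit closure of \<open>q m\<close>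
  supplies the invariant compact set that an attractor needs to exist.\<close>

lemma attractor_is_attractor:
  assumes t: "0 \<le> t" "t < t0"
  shows "is_attractor (family N f q t) (attractor (family N f q t))"
proof -
  define M where "M = closure (\<Union>n. (hutchinson (family N f q t) ^^ n) {q m})"
  have M: "compact M" "M \<noteq> {}" "hutchinson (family N f q t) M = M"
    using orbit_closure_family_invariant[of t] t by (auto simp: invariant_def M_def)
  have c: "0 \<le> t * r m" "t * r m < 1"
    using t r_pos[OF m_in] by (simp_all add: t0_def field_simps)
  have "dist (g x) (g y) \<le> t * r m * dist x y" if g: "g \<in> family N f q t" for g x y
  proof -
    obtain i where i: "i \<in> {1..N}" "g = family_map f q i t"
      using g by (auto simp: family_def)
    have "r i \<le> r m"
      using dominant[OF i(1)] by auto
    then show ?thesis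
      using t by (simp add: i(2) dist_family_map[OF i(1) t(1)] mult_left_mono mult_right_mono)
  qed
  then have "is_attractor (family N f q t) M"
    using is_attractor_if_contractive[OF family_finite_nonempty _ c M] by blast
  then show ?thesis
    using attractor_eq by metis
qed

lemma fixed_points_in_attractor:
  assumes "0 \<le> t" "t < t0" "i \<in> {1..N}"
  shows "q i \<in> attractor (family N f q t)"
  using fixed_point_in_attractor[OF attractor_is_attractor[OF assms(1,2)] family_map_mem[OF assms(3)]
      family_map_fixed[OF assms(3)]] .

text \<open>The attractor is the orbit closure of \<open>q m\<close>: the iterates of this invariant set are constant, so
  it is its own limit.\<close>

lemma hutchinson_attractor:
  assumes "0 \<le> t" "t < t0"
  shows "hutchinson (family N f q t) (attractor (family N f q t)) = attractor (family N f q t)"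
proof -
  define M where "M = closure (\<Union>n. (hutchinson (family N f q t) ^^ n) {q m})"
  let ?A = "attractor (family N f q t)"
  have M: "compact M" "M \<noteq> {}" "hutchinson (family N f q t) M = M"
    using orbit_closure_family_invariant[of t] assms by (auto simp: invariant_def M_def)
  have "hausdorff_limit (\<lambda>k. (hutchinson (family N f q t) ^^ k) M) ?A"
    using attractor_is_attractor[OF assms] M by (simp add: is_attractor_def)
  moreover have fix_M: "(hutchinson (family N f q t) ^^ k) M = M" for k
    using M(3) by (induction k) auto
  ultimately have lim: "hausdorff_limit (\<lambda>k. M) ?A"
    by simp
  have "M \<subseteq> ?A"
    using hausdorff_limit_mem[OF lim, of "\<lambda>_. x" x for x] by auto
  moreover have "?A \<subseteq> M"
    using is_attractor_subset[OF attractor_is_attractor[OF assms] M(1,2)] M(3) by simp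
  ultimately show ?thesis
    using M(3) by simp
qed

section \<open>Convex hulls of the attractors\<close>

text \<open>Affine maps commute with taking convex hulls.\<close>

lemma convex_hull_forward_invariant:
  assumes "hutchinson (family N f q t) X \<subseteq> X"
  shows "hutchinson (family N f q t) (convex hull X) \<subseteq> convex hull X"
  unfolding hutchinson_family_subset_iff
proof (intro ballI)
  fix i x assume i: "i \<in> {1..N}" and x: "x \<in> convex hull X"
  have lin: "linear (\<lambda>x. t *\<^sub>R L i x)"
    using linear_L[OF i] by (rule linear_compose_scale_right)
  have eq: "family_map f q i t y = (q i - t *\<^sub>R L i (q i)) + t *\<^sub>R L i y" for y
    by (simp add: family_map_eq[OF i] linear_diff[OF linear_L[OF i]] algebra_simps)
  have "family_map f q i t ` (convex hull X) = convex hull (family_map f q i t ` X)"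
  proof -
    have "family_map f q i t ` Y = (\<lambda>y. (q i - t *\<^sub>R L i (q i)) + y) ` (\<lambda>y. t *\<^sub>R L i y) ` Y" for Y
      by (auto simp: eq image_image)
    then show ?thesis
      by (simp add: convex_hull_translation convex_hull_linear_image[OF lin])
  qed
  also have "\<dots> \<subseteq> convex hull X"
    using assms i by (intro hull_mono) (auto simp: hutchinson_family_subset_iff)
  finally show "family_map f q i t x \<in> convex hull X"
    using x by blast
qed

text \<open>The image of \<open>x\<close> at parameter \<open>s\<close> lies on the segment between \<open>q i\<close> and the image of \<open>x\<close> at
  parameter \<open>t\<close>.\<close>

lemma forward_invariant_smaller_parameter:
  assumes C: "convex C" "hutchinson (family N f q t) C \<subseteq> C"
    and q: "\<And>i. i \<in> {1..N} \<Longrightarrow> q i \<in> C" and s: "0 \<le> s" "s \<le> t"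
  shows "hutchinson (family N f q s) C \<subseteq> C"
proof (cases "t = 0")
  case True
  then show ?thesis
    using assms by simp
next
  case False
  show ?thesis
    unfolding hutchinson_family_subset_iff
  proof (intro ballI)
    fix i x assume i: "i \<in> {1..N}" and x: "x \<in> C"
    have "family_map f q i t x \<in> C"
      using C(2) i x by (simp add: hutchinson_family_subset_iff)
    then have "(1 - s / t) *\<^sub>R q i + (s / t) *\<^sub>R family_map f q i t x \<in> C"
      by (rule convexD[OF C(1) q[OF i]]) (use s False in auto)
    then show "family_map f q i s x \<in> C"
      by (simp only: family_map_convex_combination[OF i False, of s x])
  qed
qed

lemma attractor_subset:
  assumes C: "compact C" "convex C" "hutchinson (family N f q t) C \<subseteq> C"
    and q: "\<And>i. i \<in> {1..N} \<Longrightarrow> q i \<in> C" and s: "0 \<le> s" "s \<le> t" "s < t0"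
  shows "attractor (family N f q s) \<subseteq> C"
proof -
  have "C \<noteq> {}"
    using q[OF m_in] by blast
  then show ?thesis
    using is_attractor_subset[OF attractor_is_attractor[OF s(1,3)] C(1)]
      forward_invariant_smaller_parameter[OF C(2,3) q s(1,2)] by blast
qed

lemma convex_hull_attractor_mono:
  assumes "0 \<le> s" "s \<le> t" "t < t0"
  shows "convex hull (attractor (family N f q s)) \<subseteq> convex hull (attractor (family N f q t))"
proof (intro hull_minimal attractor_subset)
  show "compact (convex hull (attractor (family N f q t)))"
    using attractor_is_attractor[of t] assms compact_convex_hull by (auto simp: is_attractor_def)
  show "hutchinson (family N f q t) (convex hull (attractor (family N f q t)))
      \<subseteq> convex hull (attractor (family N f q t))"
    using assms by (intro convex_hull_forward_invariant) (simp add: hutchinson_attractor)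
  show "q i \<in> convex hull (attractor (family N f q t))" if "i \<in> {1..N}" for i
    using fixed_points_in_attractor[of t i] assms that by (intro hull_inc) auto
qed (use assms in auto)

text \<open>An increasing union of convex sets is convex.\<close>

lemma convex_closure_Union_hulls:
  "convex (closure (\<Union>t\<in>{0..<t0}. convex hull (attractor (family N f q t))))"
proof (rule convex_closure, rule convexI)
  let ?H = "\<lambda>t. convex hull (attractor (family N f q t))"
  fix x y and u v :: real
  assume "x \<in> (\<Union>t\<in>{0..<t0}. ?H t)" "y \<in> (\<Union>t\<in>{0..<t0}. ?H t)"
    and uv: "0 \<le> u" "0 \<le> v" "u + v = 1"
  then obtain s t where s: "s \<in> {0..<t0}" "x \<in> ?H s" and t: "t \<in> {0..<t0}" "y \<in> ?H t"
    by blast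
  have max: "max s t \<in> {0..<t0}"
    using s t by auto
  have "x \<in> ?H (max s t)" "y \<in> ?H (max s t)"
    using s t convex_hull_attractor_mono[of s "max s t"] convex_hull_attractor_mono[of t "max s t"]
    by auto
  then have "u *\<^sub>R x + v *\<^sub>R y \<in> ?H (max s t)"
    using uv by (intro convexD convex_convex_hull)
  then show "u *\<^sub>R x + v *\<^sub>R y \<in> (\<Union>t\<in>{0..<t0}. ?H t)"
    using max by blast
qed


section \<open>The limit system\<close>

text \<open>At \<open>t0\<close> the map with index \<open>m\<close> is an isometry, hence maps the compact set \<open>X\<close> onto itself, and
  this one map already covers \<open>X\<close>.\<close>

lemma forward_invariant_imp_invariant:
  assumes X: "compact X" "q m \<in> X" "hutchinson (family N f q t0) X \<subseteq> X"
  shows "invariant (family N f q t0) (q m) X"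
proof -
  have "family_map f q m t0 ` X = X"
  proof (rule isometry_image_compact_eq[OF X(1)])
    show "family_map f q m t0 ` X \<subseteq> X"
      using X(3) m_in by (auto simp: hutchinson_family_subset_iff)
    show "dist (family_map f q m t0 x) (family_map f q m t0 y) = dist x y" for x y
      using t0_pos r_pos[OF m_in] by (simp add: dist_family_map[OF m_in] t0_def)
  qed
  then have "X \<subseteq> hutchinson (family N f q t0) X"
    using family_map_mem[OF m_in, of t0] by (auto simp: hutchinson_def)
  then show ?thesis
    using X by (auto simp: invariant_def)
qed

text \<open>Either \<open>q i = q m\<close>, or the map with index \<open>i\<close> is still a contraction at \<open>t0\<close> and the iterates of
  \<open>q m\<close> under it converge to \<open>q i\<close> inside \<open>X\<close>.\<close>

lemma fixed_points_in_invariant: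
  assumes X: "invariant (family N f q t0) (q m) X" and i: "i \<in> {1..N}"
  shows "q i \<in> X"
  using dominant[OF i]
proof
  assume "q i = q m \<and> r i = r m"
  then show ?thesis
    using X by (simp add: invariant_def)
next
  assume less: "r i < r m"
  let ?g = "family_map f q i t0"
  have gX: "?g x \<in> X" if "x \<in> X" for x
    using X that hutchinson_family_subset_iff[of t0 X X] i by (auto simp: invariant_def)
  have mem: "(?g ^^ n) (q m) \<in> X" for n
    using X gX by (induction n) (auto simp: invariant_def)
  have dist: "dist ((?g ^^ n) (q m)) (q i) = (t0 * r i) ^ n * dist (q m) (q i)" for n
  proof (induction n)
    case (Suc n)
    have "dist (?g ((?g ^^ n) (q m))) (?g (q i)) = t0 * r i * dist ((?g ^^ n) (q m)) (q i)"
      using t0_pos by (simp add: dist_family_map[OF i])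
    then show ?case
      using Suc by (simp add: family_map_fixed[OF i])
  qed simp
  have "(\<lambda>n. (t0 * r i) ^ n * dist (q m) (q i)) \<longlonglongrightarrow> 0"
    using t0_pos r_pos[OF i] t0_mult_less[OF i less]
    by (intro tendsto_mult_left_zero LIMSEQ_realpow_zero) auto
  then have lim: "(\<lambda>n. (?g ^^ n) (q m)) \<longlonglongrightarrow> q i"
    by (subst tendsto_dist_iff) (simp add: dist)
  have "closed X"
    using X compact_imp_closed by (auto simp: invariant_def)
  then show ?thesis
    using mem lim by (rule closed_sequentially)
qed

text \<open>Forward invariance passes to the limit by joint continuity of \<open>family_map f q i t x\<close> in \<open>t\<close> and
  \<open>x\<close>, and \<open>q m\<close> belongs to all attractors. The reverse inclusion comes from the isometry.\<close>

lemma limit_of_attractors_invariant: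
  assumes t: "\<And>k. 0 \<le> t k" "\<And>k. t k < t0" "t \<longlonglongrightarrow> t0"
    and lim: "hausdorff_limit (\<lambda>k. attractor (family N f q (t k))) A"
  shows "invariant (family N f q t0) (q m) A"
proof (rule forward_invariant_imp_invariant)
  show "compact A"
    using lim by (simp add: hausdorff_limit_def)
  show "q m \<in> A"
    using fixed_points_in_attractor[OF t(1,2) m_in]
    by (rule hausdorff_limit_mem[OF lim, of "\<lambda>_. q m"]) simp
  show "hutchinson (family N f q t0) A \<subseteq> A"
    unfolding hutchinson_family_subset_iff
  proof (intro ballI)
    fix i a assume i: "i \<in> {1..N}" and a: "a \<in> A"
    obtain x where x: "\<And>k. x k \<in> attractor (family N f q (t k))" "x \<longlonglongrightarrow> a"
      using hausdorff_limit_approx[OF lim a] by blast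
    have bl: "bounded_linear (L i)"
      using linear_L[OF i] linear_conv_bounded_linear by blast
    have lim_images: "(\<lambda>k. family_map f q i (t k) (x k)) \<longlonglongrightarrow> family_map f q i t0 a"
      unfolding family_map_eq[OF i]
      by (intro tendsto_intros t(3) x(2) bounded_linear.tendsto[OF bl])
    have "family_map f q i (t k) (x k) \<in> attractor (family N f q (t k))" for k
      using hutchinson_attractor[OF t(1,2)] x(1) i
        hutchinson_family_subset_iff[of "t k" "attractor (family N f q (t k))"
          "attractor (family N f q (t k))"] by auto
    then show "family_map f q i t0 a \<in> A"
      using lim_images by (rule hausdorff_limit_mem[OF lim])
  qed
qed

lemma convex_hull_invariant:
  assumes "invariant (family N f q t0) (q m) X"
  shows "invariant (family N f q t0) (q m) (convex hull X)"
  using assms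
  by (intro forward_invariant_imp_invariant convex_hull_forward_invariant)
    (auto simp: invariant_def compact_convex_hull hull_inc)

lemma transition_hull_subset:
  assumes X: "invariant (family N f q t0) (q m) X" "convex X"
  shows "closure (\<Union>t\<in>{0..<t0}. convex hull (attractor (family N f q t))) \<subseteq> X"
proof (intro closure_minimal UN_least hull_minimal)
  fix t assume "t \<in> {0..<t0}"
  then show "attractor (family N f q t) \<subseteq> X"
    using X fixed_points_in_invariant[OF X(1)]
    by (intro attractor_subset[of X t0]) (auto simp: invariant_def)
qed (use X compact_imp_closed in \<open>auto simp: invariant_def\<close>)

end

lemma unique_minimal_set_if_least:
  assumes "P X" "\<And>Y. P Y \<Longrightarrow> X \<subseteq> Y"
  shows "unique_minimal_set P X"
  using assms unfolding unique_minimal_set_def minimal_set_def by blast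

theorem theorem8p2:
  fixes N :: nat
    and f :: "nat \<Rightarrow> real^'d \<Rightarrow> real^'d"
    and q :: "nat \<Rightarrow> real^'d"
    and A_up A_low K :: "(real^'d) set"
    and F :: "(real^'d \<Rightarrow> real^'d) set"
    and p :: "real^'d"
  assumes "bounded_family N f q"
    and "upper_transition_attractor N f q A_up"
    and "F = family N f q (threshold N f)"
    and "p = special_point N f q"
    and "A_low = lower_transition_attractor N f q"
    and "K = transition_hull N f q"
  shows "invariant F p A_up
    \<and> unique_minimal_set (invariant F p) A_low
    \<and> unique_minimal_set (\<lambda>X. invariant F p X \<and> convex X) K
    \<and> (convex hull A_low = convex hull A_up \<and> convex hull A_up = K)
    \<and> A_low = closure (\<Union>n. (hutchinson F ^^ n) {p})"
proof -
  obtain m where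
    norm: "normalized_family N m f q (\<lambda>i. (*v) (linear_part (f i))) (\<lambda>i. scaling_ratio (f i))"
    and thr: "threshold N f = 1 / scaling_ratio (f m)" and sp: "special_point N f q = q m"
    using bounded_family_normalized[OF assms(1)] by blast
  interpret normalized_family N m f q "\<lambda>i. (*v) (linear_part (f i))" "\<lambda>i. scaling_ratio (f i)"
    by (rule norm)
  have thr: "threshold N f = t0"
    using thr by (simp add: t0_def)
  have F: "F = family N f q t0" and p: "p = q m"
    using assms thr sp by simp_all
  have K: "K = closure (\<Union>t\<in>{0..<t0}. convex hull (attractor (family N f q t)))"
    using assms thr by (simp add: transition_hull_def)
  define M where "M = closure (\<Union>n. (hutchinson F ^^ n) {p})"
  have M_inv: "invariant F p M"
    unfolding M_def F p using t0_pos by (intro orbit_closure_family_invariant) auto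
  have M_least: "M \<subseteq> X" if "invariant F p X" for X
    unfolding M_def using that compact_imp_closed
    by (intro orbit_closure_subset) (auto simp: invariant_def)
  have A_low: "A_low = M"
    using M_inv M_least unfolding assms(5) lower_transition_attractor_def thr sp F p by blast
  obtain t where t: "\<And>k. 0 \<le> t k" "\<And>k. t k < t0" "t \<longlonglongrightarrow> t0"
    "hausdorff_limit (\<lambda>k. attractor (family N f q (t k))) A_up"
    using assms(2) unfolding upper_transition_attractor_def thr by blast
  have up_inv: "invariant F p A_up"
    unfolding F p using limit_of_attractors_invariant[OF t] .
  have "A_up \<subseteq> K"
  proof
    fix a assume "a \<in> A_up"
    then obtain x where x: "\<And>k. x k \<in> attractor (family N f q (t k))" "x \<longlonglongrightarrow> a"
      using hausdorff_limit_approx[OF t(4)] by blast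
    have "x k \<in> K" for k
    proof -
      have "x k \<in> convex hull (attractor (family N f q (t k)))"
        using x(1) by (rule hull_inc)
      then have "x k \<in> (\<Union>s\<in>{0..<t0}. convex hull (attractor (family N f q s)))"
        using t(1,2) by (intro UN_I[of "t k"]) simp_all
      then show ?thesis
        unfolding K using closure_subset by (rule rev_subsetD)
    qed
    moreover have "closed K"
      by (simp add: K)
    ultimately show "a \<in> K"
      using x(2) closed_sequentially[of K x a] by simp
  qed
  then have "convex hull A_up \<subseteq> K"
    unfolding K by (intro hull_minimal convex_closure_Union_hulls)
  moreover have "convex hull M \<subseteq> convex hull A_up"
    using M_least[OF up_inv] by (rule hull_mono)
  moreover have M_hull: "invariant F p (convex hull M)"
    using convex_hull_invariant M_inv unfolding F p .
  moreover have K_least: "K \<subseteq> X" if "invariant F p X" "convex X" for X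
    using transition_hull_subset that unfolding K F p .
  ultimately have hulls: "convex hull M = K" "convex hull A_up = K"
    using K_least[OF M_hull convex_convex_hull] by auto
  have "unique_minimal_set (invariant F p) A_low"
    unfolding A_low using M_inv M_least by (rule unique_minimal_set_if_least)
  moreover have "unique_minimal_set (\<lambda>X. invariant F p X \<and> convex X) K"
    using M_hull K_least hulls convex_convex_hull[of M]
    by (intro unique_minimal_set_if_least) auto
  ultimately show ?thesis
    using up_inv hulls by (simp add: A_low flip: M_def)
qed

end
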